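(* Let $\phi:\mathbb{R}\to\mathbb{R}_+$ be a radially decreasing, smooth or weakly singular interaction protocol satisfying, for some $s\in[0,1)$ and constants $\lambda>0$, $R_0>0$, $$\lambda|x|^{-s}\le\phi(x),\qquad |x|<R_0 .$$ Let $X(\cdot,t)$, $t\ge0$, be the flow map of a solution of the one-dimensional Euler Alignment model (with $\kappa=1$) on the bounded open set $\Omega\subset\mathbb{R}$, with mass measure $m$ and associated function $\psi_0$, as defined in the context. For $\alpha,\beta\in\Omega$ with $\alpha<\beta$ write $X_{\beta\alpha}(t)=X(\beta,t)-X(\alpha,t)$ and $\psi_{\beta\alpha}=\psi_0(\beta)-\psi_0(\alpha)$. Then for all such pairs $(\alpha,\beta)$ satisfying $$\max\left\{\beta-\alpha,\ \left(\frac{(1-s)\psi_{\beta\alpha}}{\lambda\, m([\alpha,\beta])}\right)^{\frac1{1-s}}\right\}\le R_0,$$ one has $$\dot X_{\beta\alpha}\le\psi_{\beta\alpha}-\frac{\lambda\, m([\alpha,\beta])}{1-s}X_{\beta\alpha}^{1-s}.$$ Consequently, $$\sup_{t\ge0}X_{\beta\alpha}(t)\le\max\left\{\beta-\alpha,\ \left(\frac{(1-s)\psi_{\beta\alpha}}{\lambda\, m([\alpha,\beta])}\right)^{\frac1{1-s}}\right\}\le R_0 .$$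
   Context: Radially decreasing means that $\phi(x)$ depends only on $|x|$ and is nonincreasing in $|x|$. Weakly singular means that $\phi$ is locally integrable with a singularity at the origin like $|x|^{-s}$ for some $s\in(0,1)$; the case $s=0$ corresponds to bounded kernels. Setting (1D Euler Alignment in Lagrangian variables, $\kappa=1$): $\Omega=\{\rho_0>0\}\subset\mathbb{R}$ is bounded and open, $u_0:\Omega\to\mathbb{R}$ is the initial velocity, $dm_\gamma=\rho_0(\gamma)\,d\gamma$ is the initial mass measure, of finite total mass, regarded as a measure on $\mathbb{R}$ supported in $\overline\Omega$. With $\varphi(x)=\int_0^x\phi(y)\,dy$, put $\psi_0(\alpha)=u_0(\alpha)+\int_\Omega\varphi(\alpha-\gamma)\,dm_\gamma$ for $\alpha\in\Omega$. The flow $X$ satisfies $$\dot X(\alpha,t)=\psi_0(\alpha)-\int_\Omega\varphi(X(\alpha,t)-X(\gamma,t))\,dm_\gamma,\qquad X(\alpha,0)=\alpha,\qquad \alpha\in\Omega,$$ which is the integrated form of the system $\dot X(\alpha,t)=V(\alpha,t)$, $\dot V(\alpha,t)=\int_\Omega\phi(X(\alpha,t)-X(\gamma,t))(V(\gamma,t)-V(\alpha,t))\,dm_\gamma$, $X(\alpha,0)=\alpha$, $V(\alpha,0)=u_0(\alpha)$. Being the flow map of a solution of the Euler Alignment model, $X(\cdot,t):\Omega\to X(\Omega,t)$ is bijective and order preserving ($\alpha<\beta$ implies $X(\alpha,t)<X(\beta,t)$) for every $t$ in the time interval of existence; times $t\ge0$ in the claim range over this interval. *)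

theory Defs
  imports "HOL-Analysis.Analysis" "HOL-Library.Landau_Symbols"
begin

(* A singular kernel has no meaningful value at 0, so monotonicity compares values only with
   points away from 0; for continuous kernels this extends to 0 by continuity. *)
definition radially_decreasing :: "(real \<Rightarrow> real) \<Rightarrow> bool" where
  "radially_decreasing \<phi> \<longleftrightarrow>
     (\<forall>x y. \<bar>x\<bar> = \<bar>y\<bar> \<longrightarrow> \<phi> x = \<phi> y) \<and>
     (\<forall>x y. 0 < \<bar>x\<bar> \<and> \<bar>x\<bar> \<le> \<bar>y\<bar> \<longrightarrow> \<phi> y \<le> \<phi> x)"

definition smooth_kernel :: "(real \<Rightarrow> real) \<Rightarrow> bool" where
  "smooth_kernel \<phi> \<longleftrightarrow> (\<forall>k. (deriv ^^ k) \<phi> differentiable_on UNIV)"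

definition weakly_singular :: "(real \<Rightarrow> real) \<Rightarrow> bool" where
  "weakly_singular \<phi> \<longleftrightarrow>
     (\<forall>K. compact K \<longrightarrow> set_integrable lborel K \<phi>) \<and>
     (\<exists>\<sigma>. 0 < \<sigma> \<and> \<sigma> < 1 \<and> \<phi> \<in> \<Theta>[at 0](\<lambda>x. \<bar>x\<bar> powr (- \<sigma>)))"

(* The signed integral of the kernel from 0 to x. *)
definition kernel_primitive :: "(real \<Rightarrow> real) \<Rightarrow> real \<Rightarrow> real" where
  "kernel_primitive \<phi> x = (LBINT y=0..x. \<phi> y)"

definition mass_measure :: "(real \<Rightarrow> real) \<Rightarrow> real measure" where
  "mass_measure \<rho>0 = density lborel (\<lambda>\<gamma>. ennreal (\<rho>0 \<gamma>))"

(* Integrability of the density encodes finite total mass. *)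
definition initial_density :: "real set \<Rightarrow> (real \<Rightarrow> real) \<Rightarrow> bool" where
  "initial_density \<Omega> \<rho>0 \<longleftrightarrow>
     (\<forall>x. 0 \<le> \<rho>0 x) \<and> \<Omega> = {x. 0 < \<rho>0 x} \<and> open \<Omega> \<and> bounded \<Omega> \<and> integrable lborel \<rho>0"

definition psi0 ::
  "(real \<Rightarrow> real) \<Rightarrow> real set \<Rightarrow> (real \<Rightarrow> real) \<Rightarrow> (real \<Rightarrow> real) \<Rightarrow> real \<Rightarrow> real" where
  "psi0 \<phi> \<Omega> \<rho>0 u0 \<alpha> =
     u0 \<alpha> + (LINT \<gamma>:\<Omega>|mass_measure \<rho>0. kernel_primitive \<phi> (\<alpha> - \<gamma>))"

(* Any time interval [0,T), [0,T] (T > 0) or [0,\<infinity>). *)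
definition existence_interval :: "real set \<Rightarrow> bool" where
  "existence_interval I \<longleftrightarrow> is_interval I \<and> 0 \<in> I \<and> I \<subseteq> {0..} \<and> I \<noteq> {0}"

(* The Lagrangian flow map on the time interval I.  Integrability of the interaction term is
   part of being a solution, since a non-integrable function has Bochner integral 0. The time
   derivative is one-sided at the end points of I. Bijectivity onto the image is contained in
   strict monotonicity. *)
definition euler_alignment_flow ::
  "(real \<Rightarrow> real) \<Rightarrow> real set \<Rightarrow> (real \<Rightarrow> real) \<Rightarrow> (real \<Rightarrow> real) \<Rightarrow> real set \<Rightarrow>
    (real \<Rightarrow> real \<Rightarrow> real) \<Rightarrow> bool" where
  "euler_alignment_flow \<phi> \<Omega> \<rho>0 u0 I X \<longleftrightarrow>
     (\<forall>\<alpha>\<in>\<Omega>. X \<alpha> 0 = \<alpha>) \<and>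
     (\<forall>t\<in>I. strict_mono_on \<Omega> (\<lambda>\<alpha>. X \<alpha> t)) \<and>
     (\<forall>\<alpha>\<in>\<Omega>. \<forall>t\<in>I.
        set_integrable (mass_measure \<rho>0) \<Omega> (\<lambda>\<gamma>. kernel_primitive \<phi> (X \<alpha> t - X \<gamma> t)) \<and>
        ((\<lambda>\<tau>. X \<alpha> \<tau>) has_real_derivative
           (psi0 \<phi> \<Omega> \<rho>0 u0 \<alpha> -
            (LINT \<gamma>:\<Omega>|mass_measure \<rho>0. kernel_primitive \<phi> (X \<alpha> t - X \<gamma> t)))) (at t within I))"

(* The power x^p of the positive part of x.  It is used for a base that is negative when
   psi0 \<beta> < psi0 \<alpha>, which solutions on a bounded time interval do not exclude; the power is then
   0 and drops out of a maximum with a positive number. *)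
definition pos_powr :: "real \<Rightarrow> real \<Rightarrow> real" where
  "pos_powr x p = max 0 x powr p"

end

theory Submission
  imports Defs
begin

text \<open>Write \<open>K\<close> for the primitive of the kernel and \<open>y\<close> for the distance of the two trajectories. As \<open>K\<close> is
  odd, nondecreasing and subadditive on the positive half-line, the difference of the two
  interaction integrals is at least \<open>m([\<alpha>,\<beta>]) * K y\<close>: labels outside \<open>[\<alpha>,\<beta>]\<close> contribute a nonnegative
  amount, and each label in between splits \<open>y\<close> into two nonnegative parts. The lower bound on the
  kernel turns this into the differential inequality as long as \<open>y \<le> R0\<close>, and the derivative of \<open>y\<close> is
  nonpositive wherever \<open>y\<close> exceeds the claimed bound.\<close>

text \<open>Common ground of the smooth and the weakly singular case: either regularity class gives
  integrability on compact intervals.\<close>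

locale alignment_kernel =
  fixes \<phi> :: "real \<Rightarrow> real"
  assumes nonneg: "0 \<le> \<phi> x"
    and decreasing: "radially_decreasing \<phi>"
    and locally_integrable: "set_integrable lborel {a..b} \<phi>"
begin

abbreviation K :: "real \<Rightarrow> real" where "K \<equiv> kernel_primitive \<phi>"

lemma integrable_on_Icc: "\<phi> integrable_on {a..b}"
  by (rule set_borel_integral_eq_integral(1)[OF locally_integrable])

text \<open>Passes from the oriented Lebesgue integral that defines \<open>K\<close> to the gauge
  integral, in which the comparisons below are carried out.\<close>

lemma kernel_primitive_diff:
  assumes "a \<le> b"
  shows "K b - K a = integral {a..b} \<phi>"
proof -
  \<comment> \<open>Additivity asks for integrability on the hull of 0, \<open>a\<close> and
    \<open>b\<close>, and 0 may lie anywhere relative to \<open>a\<close> and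
    \<open>b\<close>.\<close>
  have "interval_lebesgue_integrable lborel (ereal (min 0 (min a b))) (ereal (max 0 (max a b))) \<phi>"
    unfolding interval_lebesgue_integrable_def einterval_eq
    using set_integrable_subset[OF locally_integrable[of "min 0 (min a b)" "max 0 (max a b)"],
        of "{min 0 (min a b)<..<max 0 (max a b)}"]
    by (auto simp: subset_iff)
  hence "(LBINT x=ereal 0..ereal a. \<phi> x) + (LBINT x=ereal a..ereal b. \<phi> x) = (LBINT x=ereal 0..ereal b. \<phi> x)"
    by (intro interval_integral_sum) (simp add: zero_ereal_def)
  hence "K a + (LBINT x=a..b. \<phi> x) = K b"
    by (simp add: kernel_primitive_def zero_ereal_def)
  thus ?thesis
    using interval_integral_eq_integral[OF assms locally_integrable] by simp
qed

lemma kernel_primitive_0 [simp]: "K 0 = 0"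
  by (simp add: kernel_primitive_def zero_ereal_def)

lemma kernel_primitive_mono:
  assumes "a \<le> b"
  shows "K a \<le> K b"
  using kernel_primitive_diff[OF assms] integral_nonneg[OF integrable_on_Icc, of a b] nonneg
  by fastforce

lemma kernel_primitive_minus: "K (- x) = - K x"
proof -
  have even: "\<phi> (- y) = \<phi> y" for y
    using decreasing unfolding radially_decreasing_def by (metis abs_minus_cancel)
  have "K (- x) = (LBINT y=ereal 0..ereal (-x). \<phi> y)"
    by (simp add: kernel_primitive_def zero_ereal_def)
  also have "\<dots> = (LBINT y=ereal x..ereal 0. \<phi> y)"
    by (subst interval_integral_reflect) (simp add: even)
  also have "\<dots> = - (LBINT y=ereal 0..ereal x. \<phi> y)"
    by (rule interval_integral_endpoints_reverse)
  finally show ?thesis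
    by (simp add: kernel_primitive_def zero_ereal_def)
qed

text \<open>Since \<open>\<phi>\<close> decreases away from the origin, moving the window
  \<open>{a..a+b}\<close> back to \<open>{0..b}\<close> cannot lower the integral.\<close>

lemma kernel_primitive_subadditive:
  assumes "0 \<le> a" "0 \<le> b"
  shows "K (a + b) \<le> K a + K b"
proof -
  have "((\<lambda>x. \<phi> (x + a)) has_integral integral {a..a+b} \<phi>) {0..b}"
    using has_integral_affinity'[of \<phi> "integral {a..a+b} \<phi>" a "a+b" 1 a]
      integrable_integral[OF integrable_on_Icc] by simp
  \<comment> \<open>The endpoint 0 is dropped because \<open>\<phi> (x + a) \<le> \<phi> x\<close>
    is not guaranteed at \<open>x = 0\<close>.\<close>
  hence shift: "((\<lambda>x. \<phi> (x + a)) has_integral integral {a..a+b} \<phi>) {0<..<b}"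
    by (simp only: has_integral_Icc_iff_Ioo)
  have unshifted: "(\<phi> has_integral integral {0..b} \<phi>) {0<..<b}"
    using integrable_integral[OF integrable_on_Icc[of 0 b]]
    by (simp only: has_integral_Icc_iff_Ioo)
  have decreasing_le: "\<phi> (x + a) \<le> \<phi> x" if "0 < x" for x
    using decreasing that \<open>0 \<le> a\<close> unfolding radially_decreasing_def
    by (metis abs_of_pos add.commute add_nonneg_pos le_add_same_cancel1)
  have "integral {a..a+b} \<phi> \<le> integral {0..b} \<phi>"
    by (rule has_integral_le[OF shift unshifted])
      (use decreasing_le assms in auto)
  thus ?thesis
    using kernel_primitive_diff[of a "a+b"] kernel_primitive_diff[of 0 b] assms by simp
qed

text \<open>Integrates the pointwise bound, with \<open>s < 1\<close> making the power integrable at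
  0. The case \<open>x = R\<close> is included because the barrier level in the theorem may equal
  \<open>R0\<close>.\<close>

lemma kernel_primitive_powr_le:
  assumes "s < 1" "0 \<le> x" "x \<le> R"
    and lower: "\<And>y. \<bar>y\<bar> < R \<Longrightarrow> c * \<bar>y\<bar> powr (- s) \<le> \<phi> y"
  shows "c / (1 - s) * x powr (1 - s) \<le> K x"
proof -
  have "((\<lambda>y. c * y powr (- s)) has_integral c * (x powr (- s + 1) / (- s + 1))) {0..x}"
    by (intro has_integral_mult_right has_integral_powr_from_0) (use assms in auto)
  \<comment> \<open>On the open interval every point satisfies \<open>y < R\<close>, even when
    \<open>x = R\<close>.\<close>
  hence power: "((\<lambda>y. c * y powr (- s)) has_integral c * (x powr (- s + 1) / (- s + 1))) {0<..<x}"
    by (simp only: has_integral_Icc_iff_Ioo)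
  have kernel: "(\<phi> has_integral integral {0..x} \<phi>) {0<..<x}"
    using integrable_integral[OF integrable_on_Icc[of 0 x]]
    by (simp only: has_integral_Icc_iff_Ioo)
  have "c * (x powr (- s + 1) / (- s + 1)) \<le> integral {0..x} \<phi>"
  proof (rule has_integral_le[OF power kernel])
    fix y assume "y \<in> {0<..<x}"
    thus "c * y powr (- s) \<le> \<phi> y" using lower[of y] assms by auto
  qed
  thus ?thesis
    using kernel_primitive_diff[of 0 x] assms by simp
qed

text \<open>Used at a frozen time: \<open>Y\<close> is the flow map, \<open>A\<close> the set of all
  labels and \<open>B\<close> the set of labels between \<open>a\<close> and \<open>b\<close>. The
  estimate is pointwise in the label and then integrated.\<close>

lemma interaction_diff_ge:
  assumes [measurable]: "A \<in> sets M" "B \<in> sets M" and fin: "emeasure M B \<noteq> \<infinity>"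
    and "B \<subseteq> A" "mono_on A Y" "a \<in> A" "b \<in> A" "a \<le> b"
    and between: "\<And>\<gamma>. \<gamma> \<in> B \<Longrightarrow> a \<le> \<gamma> \<and> \<gamma> \<le> b"
    and inta: "set_integrable M A (\<lambda>\<gamma>. K (Y a - Y \<gamma>))"
    and intb: "set_integrable M A (\<lambda>\<gamma>. K (Y b - Y \<gamma>))"
  shows "measure M B * K (Y b - Y a)
      \<le> (LINT \<gamma>:A|M. K (Y b - Y \<gamma>)) - (LINT \<gamma>:A|M. K (Y a - Y \<gamma>))"
proof -
  have le: "Y x \<le> Y y" if "x \<in> A" "y \<in> A" "x \<le> y" for x y
    using assms(5) that by (auto simp: mono_on_def)
  have split: "K (Y b - Y a) \<le> K (Y b - Y \<gamma>) - K (Y a - Y \<gamma>)" if "\<gamma> \<in> B" for \<gamma>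
  proof -
    have "\<gamma> \<in> A" using that assms(4) by auto
    hence "0 \<le> Y b - Y \<gamma>" "0 \<le> Y \<gamma> - Y a"
      using le[of a \<gamma>] le[of \<gamma> b] between[OF that] assms by auto
    \<comment> \<open>The summands are the distances from \<open>Y \<gamma>\<close> to
      \<open>Y b\<close> and to \<open>Y a\<close>; oddness turns
      \<open>K (Y \<gamma> - Y a)\<close> into \<open>- K (Y a - Y \<gamma>)\<close>.\<close>
    from kernel_primitive_subadditive[OF this] show ?thesis
      using kernel_primitive_minus[of "Y \<gamma> - Y a"] by simp
  qed
  have "measure M B * K (Y b - Y a) = (LINT \<gamma>|M. indicator B \<gamma> *\<^sub>R K (Y b - Y a))"
    using fin by (simp add: top.not_eq_extremum)
  also have "\<dots> \<le> (LINT \<gamma>:A|M. K (Y b - Y \<gamma>) - K (Y a - Y \<gamma>))"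
    unfolding set_lebesgue_integral_def
  proof (rule integral_mono)
    show "integrable M (\<lambda>\<gamma>. indicator B \<gamma> *\<^sub>R K (Y b - Y a))"
      using fin by (simp add: top.not_eq_extremum)
    show "integrable M (\<lambda>\<gamma>. indicator A \<gamma> *\<^sub>R (K (Y b - Y \<gamma>) - K (Y a - Y \<gamma>)))"
      using set_integral_diff(1)[OF intb inta] by (simp add: set_integrable_def)
    fix \<gamma>
    \<comment> \<open>Handles the labels outside \<open>B\<close>, where the left-hand integrand is
      0.\<close>
    have "K (Y a - Y \<gamma>) \<le> K (Y b - Y \<gamma>)"
      using le[of a b] assms by (intro kernel_primitive_mono) auto
    thus "indicator B \<gamma> *\<^sub>R K (Y b - Y a)
        \<le> indicator A \<gamma> *\<^sub>R (K (Y b - Y \<gamma>) - K (Y a - Y \<gamma>))"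
      using split[of \<gamma>] \<open>B \<subseteq> A\<close> by (auto simp: indicator_def)
  qed
  also have "\<dots> = (LINT \<gamma>:A|M. K (Y b - Y \<gamma>)) - (LINT \<gamma>:A|M. K (Y a - Y \<gamma>))"
    by (rule set_integral_diff(2)[OF intb inta])
  finally show ?thesis .
qed

end

lemma smooth_kernel_set_integrable:
  assumes "smooth_kernel \<phi>"
  shows "set_integrable lborel {a..b} \<phi>"
proof (rule borel_integrable_atLeastAtMost')
  have "\<phi> differentiable_on UNIV"
    using assms unfolding smooth_kernel_def by (metis funpow_0)
  thus "continuous_on {a..b} \<phi>"
    using differentiable_imp_continuous_on continuous_on_subset by blast
qed

lemma finite_mass_measure:
  assumes "initial_density \<Omega> \<rho>"
  shows "emeasure (mass_measure \<rho>) A \<noteq> \<infinity>"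
proof -
  have \<rho>: "integrable lborel \<rho>" "\<And>x. 0 \<le> \<rho> x"
    using assms by (auto simp: initial_density_def)
  have [measurable]: "\<rho> \<in> borel_measurable borel"
    using borel_measurable_integrable[OF \<rho>(1)] by simp
  have "emeasure (mass_measure \<rho>) A \<le> emeasure (mass_measure \<rho>) (space (mass_measure \<rho>))"
    by (rule emeasure_space)
  also have "\<dots> = (\<integral>\<^sup>+x. ennreal (\<rho> x) \<partial>lborel)"
    by (simp add: mass_measure_def emeasure_density)
  also have "\<dots> < \<infinity>"
    using nn_integral_eq_integral[OF \<rho>(1)] \<rho>(2) by simp
  finally show ?thesis by simp
qed

text \<open>The density is positive on a neighbourhood of \<open>\<alpha>\<close>, hence on a
  nondegenerate interval to its right; zero mass would make that interval Lebesgue-null. Positivity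
  makes the quotient in the claimed bound meaningful.\<close>

lemma mass_measure_pos:
  assumes "initial_density \<Omega> \<rho>" "\<alpha> \<in> \<Omega>" "\<alpha> < \<beta>"
  shows "0 < measure (mass_measure \<rho>) {\<alpha>..\<beta>}"
proof -
  have [measurable]: "\<rho> \<in> borel_measurable borel"
    using assms borel_measurable_integrable by (fastforce simp: initial_density_def)
  obtain e where e: "e > 0" "ball \<alpha> e \<subseteq> \<Omega>"
    using assms openE unfolding initial_density_def by blast
  \<comment> \<open>Half the radius keeps the closed interval \<open>{\<alpha>..d}\<close> inside
    the open ball.\<close>
  define d where "d = min \<beta> (\<alpha> + e / 2)"
  have "\<alpha> < d" using e assms by (auto simp: d_def)
  have sub: "{\<alpha>..d} \<subseteq> {x. \<rho> x > 0} \<inter> {\<alpha>..\<beta>}"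
  proof
    fix x assume x: "x \<in> {\<alpha>..d}"
    hence "x \<in> ball \<alpha> e" using e by (auto simp: d_def dist_real_def)
    thus "x \<in> {x. \<rho> x > 0} \<inter> {\<alpha>..\<beta>}"
      using x e assms by (auto simp: d_def initial_density_def)
  qed
  have "measure (mass_measure \<rho>) {\<alpha>..\<beta>} \<noteq> 0"
  proof
    assume "measure (mass_measure \<rho>) {\<alpha>..\<beta>} = 0"
    hence "{\<alpha>..\<beta>} \<in> null_sets (mass_measure \<rho>)"
      using finite_mass_measure[OF assms(1)]
      by (auto simp: null_sets_def mass_measure_def measure_def enn2real_eq_0_iff)
    hence "AE x in lborel. x \<in> {\<alpha>..\<beta>} \<longrightarrow> ennreal (\<rho> x) = 0"
      by (simp add: mass_measure_def null_sets_density_iff)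
    hence "AE x in lborel. x \<notin> {\<alpha>..d}"
      by eventually_elim (use sub in \<open>auto simp: ennreal_eq_0_iff\<close>)
    hence "emeasure lborel {\<alpha>..d} = 0"
      by (subst (asm) AE_iff_measurable[where N="{\<alpha>..d}"]) auto
    thus False using \<open>\<alpha> < d\<close> by (simp add: ennreal_eq_0_iff)
  qed
  thus ?thesis by (simp add: less_le)
qed

text \<open>If \<open>y t\<close> exceeded \<open>M\<close>, there would be a last time
  \<open>c\<close> before \<open>t\<close> with \<open>y c \<le> M\<close>. Beyond \<open>c\<close>
  the derivative is nonpositive, so the mean value theorem gives \<open>y t \<le> y c\<close>, a
  contradiction.\<close>

lemma barrier_le:
  fixes y y' :: "real \<Rightarrow> real"
  assumes deriv: "\<And>t. t \<in> I \<Longrightarrow> (y has_real_derivative y' t) (at t within I)"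
    and I: "{a..t} \<subseteq> I" "a \<le> t"
    and init: "y a \<le> M"
    and decay: "\<And>t. t \<in> I \<Longrightarrow> M < y t \<Longrightarrow> y' t \<le> 0"
  shows "y t \<le> M"
proof (rule ccontr)
  assume "\<not> y t \<le> M"
  have deriv': "(y has_real_derivative y' \<tau>) (at \<tau> within {c..t})" if "\<tau> \<in> {c..t}" "a \<le> c" for c \<tau>
    by (rule DERIV_subset[OF deriv]) (use that I in auto)
  have cont: "continuous_on {a..t} y"
    by (rule DERIV_continuous_on[OF deriv']) auto
  define S where "S = {a..t} \<inter> y -` {..M}"
  have "closed S"
    unfolding S_def by (rule continuous_closed_preimage[OF cont]) auto
  hence "compact S"
    unfolding S_def by (metis S_def bounded_Int bounded_closed_interval compact_eq_bounded_closed)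
  moreover have "a \<in> S" using init I by (simp add: S_def)
  ultimately obtain c where c: "c \<in> S" "\<And>\<tau>. \<tau> \<in> S \<Longrightarrow> \<tau> \<le> c"
    using compact_attains_sup by (metis empty_iff)
  have "c < t" using c(1) \<open>\<not> y t \<le> M\<close> by (auto simp: S_def less_le)
  then obtain z where z: "z \<in> {c<..<t}" "y t - y c = (t - c) * y' z"
    using mvt_simple[of c t y "\<lambda>x. (*) (y' x)"] deriv'[of _ c] c(1)
    by (auto simp: S_def has_field_derivative_def mult.commute)
  have "z \<notin> S" using c(2)[of z] z(1) by auto
  hence "y' z \<le> 0" using decay[of z] I z(1) c(1) by (auto simp: S_def subset_iff)
  hence "y t \<le> y c" using z \<open>c < t\<close> by (smt (verit) mult_nonneg_nonpos)
  thus False using c(1) \<open>\<not> y t \<le> M\<close> by (auto simp: S_def)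
qed

theorem proposition5p2:
  fixes \<phi> \<rho>0 u0 :: "real \<Rightarrow> real" and \<Omega> I :: "real set"
    and X :: "real \<Rightarrow> real \<Rightarrow> real" and s lam R0 \<alpha> \<beta> :: real
  assumes phi_nonneg: "\<And>x. 0 \<le> \<phi> x"
    and phi_decreasing: "radially_decreasing \<phi>"
    and phi_regular: "smooth_kernel \<phi> \<or> weakly_singular \<phi>"
    and s: "0 \<le> s" "s < 1"
    and pos: "0 < lam" "0 < R0"
    and phi_lower: "\<And>x. \<bar>x\<bar> < R0 \<Longrightarrow> lam * \<bar>x\<bar> powr (- s) \<le> \<phi> x"
    and density: "initial_density \<Omega> \<rho>0"
    and time_interval: "existence_interval I"
    and flow: "euler_alignment_flow \<phi> \<Omega> \<rho>0 u0 I X"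
    and labels: "\<alpha> \<in> \<Omega>" "\<beta> \<in> \<Omega>" "\<alpha> < \<beta>"
    and close: "max (\<beta> - \<alpha>)
       (pos_powr ((1 - s) * (psi0 \<phi> \<Omega> \<rho>0 u0 \<beta> - psi0 \<phi> \<Omega> \<rho>0 u0 \<alpha>)
          / (lam * measure (mass_measure \<rho>0) {\<alpha>..\<beta>})) (1 / (1 - s))) \<le> R0"
  shows "(\<forall>t\<in>I. \<exists>D. ((\<lambda>\<tau>. X \<beta> \<tau> - X \<alpha> \<tau>) has_real_derivative D) (at t within I) \<and>
           D \<le> psi0 \<phi> \<Omega> \<rho>0 u0 \<beta> - psi0 \<phi> \<Omega> \<rho>0 u0 \<alpha>
               - lam * measure (mass_measure \<rho>0) {\<alpha>..\<beta>} / (1 - s)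
                 * (X \<beta> t - X \<alpha> t) powr (1 - s)) \<and>
         bdd_above ((\<lambda>t. X \<beta> t - X \<alpha> t) ` I) \<and>
         (SUP t\<in>I. X \<beta> t - X \<alpha> t) \<le> max (\<beta> - \<alpha>)
           (pos_powr ((1 - s) * (psi0 \<phi> \<Omega> \<rho>0 u0 \<beta> - psi0 \<phi> \<Omega> \<rho>0 u0 \<alpha>)
              / (lam * measure (mass_measure \<rho>0) {\<alpha>..\<beta>})) (1 / (1 - s))) \<and>
         max (\<beta> - \<alpha>)
           (pos_powr ((1 - s) * (psi0 \<phi> \<Omega> \<rho>0 u0 \<beta> - psi0 \<phi> \<Omega> \<rho>0 u0 \<alpha>)
              / (lam * measure (mass_measure \<rho>0) {\<alpha>..\<beta>})) (1 / (1 - s))) \<le> R0"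
proof -
  let ?m = "measure (mass_measure \<rho>0) {\<alpha>..\<beta>}"
  \<comment> \<open>For \<open>\<psi> > 0\<close> the second entry of the maximum \<open>M\<close>
    is the positive zero of \<open>\<psi> - c * r powr (1 - s)\<close> as a function of
    \<open>r\<close>.\<close>
  define \<psi> where "\<psi> = psi0 \<phi> \<Omega> \<rho>0 u0 \<beta> - psi0 \<phi> \<Omega> \<rho>0 u0 \<alpha>"
  define c where "c = lam * ?m / (1 - s)"
  define M where "M = max (\<beta> - \<alpha>) (pos_powr ((1 - s) * \<psi> / (lam * ?m)) (1 / (1 - s)))"
  interpret alignment_kernel \<phi>
    by standard (use phi_nonneg phi_decreasing phi_regular smooth_kernel_set_integrable in
        \<open>auto simp: weakly_singular_def\<close>)
  define y where "y t = X \<beta> t - X \<alpha> t" for t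
  define J where "J a t = (LINT \<gamma>:\<Omega>|mass_measure \<rho>0. K (X a t - X \<gamma> t))" for a t
  define y' where "y' t = \<psi> - (J \<beta> t - J \<alpha> t)" for t
  have "M \<le> R0" using close by (simp add: M_def \<psi>_def)
  have "0 < M" using labels by (simp add: M_def)
  have "0 < ?m" using mass_measure_pos[OF density] labels by blast
  hence "0 < c" using pos s by (simp add: c_def)
  have I: "0 \<in> I" "I \<subseteq> {0..}" "is_interval I"
    using time_interval by (auto simp: existence_interval_def)
  have I_Icc: "{0..t} \<subseteq> I" if "t \<in> I" for t
    using I that unfolding is_interval_1 by (meson atLeastAtMost_iff subsetI)
  have flow': "\<And>a. a \<in> \<Omega> \<Longrightarrow> X a 0 = a"
      "\<And>t. t \<in> I \<Longrightarrow> strict_mono_on \<Omega> (\<lambda>a. X a t)"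
      "\<And>a t. a \<in> \<Omega> \<Longrightarrow> t \<in> I \<Longrightarrow> set_integrable (mass_measure \<rho>0) \<Omega> (\<lambda>\<gamma>. K (X a t - X \<gamma> t))"
      "\<And>a t. a \<in> \<Omega> \<Longrightarrow> t \<in> I \<Longrightarrow>
        (X a has_real_derivative psi0 \<phi> \<Omega> \<rho>0 u0 a - J a t) (at t within I)"
    using flow by (auto simp: euler_alignment_flow_def J_def)
  have deriv: "(y has_real_derivative y' t) (at t within I)" if "t \<in> I" for t
    unfolding y_def[abs_def] y'_def \<psi>_def
    by (rule DERIV_cong[OF DERIV_diff[OF flow'(4) flow'(4)]]) (use that labels in auto)
  have y_pos: "0 < y t" if "t \<in> I" for t
    using flow'(2)[OF that] labels by (auto simp: y_def strict_mono_on_def)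
  have [measurable]: "\<Omega> \<in> sets borel"
    using density by (auto simp: initial_density_def)
  have [measurable]: "\<rho>0 \<in> borel_measurable borel"
    using density borel_measurable_integrable by (fastforce simp: initial_density_def)
  \<comment> \<open>The density vanishes outside \<open>\<Omega>\<close>, so keeping only the labels
    on which the flow is ordered loses no mass.\<close>
  have m_eq: "measure (mass_measure \<rho>0) (\<Omega> \<inter> {\<alpha>..\<beta>}) = ?m"
  proof (rule measure_eq_AE)
    show "AE x in mass_measure \<rho>0. (x \<in> \<Omega> \<inter> {\<alpha>..\<beta>}) = (x \<in> {\<alpha>..\<beta>})"
      unfolding mass_measure_def
      using density by (subst AE_density) (auto simp: initial_density_def)
  qed (auto simp: mass_measure_def)
  have y'_le: "y' t \<le> \<psi> - ?m * K (y t)" if "t \<in> I" for t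
  proof -
    have "measure (mass_measure \<rho>0) (\<Omega> \<inter> {\<alpha>..\<beta>}) * K (X \<beta> t - X \<alpha> t) \<le> J \<beta> t - J \<alpha> t"
      unfolding J_def
      by (rule interaction_diff_ge)
        (use flow'(2,3) that labels finite_mass_measure[OF density] in
          \<open>auto simp: strict_mono_on_imp_mono_on mass_measure_def\<close>)
    thus ?thesis by (simp add: y'_def y_def m_eq)
  qed
  have K_ge: "c * r powr (1 - s) \<le> ?m * K r" if "0 \<le> r" "r \<le> R0" for r
    using mult_left_mono[OF kernel_primitive_powr_le[OF s(2) that phi_lower], of ?m]
    by (simp add: c_def field_simps)
  \<comment> \<open>At distance \<open>M\<close> the right-hand side of the differential inequality
    is already nonpositive. For positive \<open>\<psi>\<close> this rests on
    \<open>c * q = \<psi>\<close> and \<open>q \<le> M powr (1 - s)\<close>.\<close>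
  have M_stationary: "\<psi> \<le> c * M powr (1 - s)"
  proof (cases "\<psi> \<le> 0")
    case True
    thus ?thesis using \<open>0 < c\<close> by (smt (verit) mult_nonneg_nonneg powr_ge_zero)
  next
    case False
    define q where "q = (1 - s) * \<psi> / (lam * ?m)"
    have "0 < q" using False s pos \<open>0 < ?m\<close> by (simp add: q_def)
    hence "q = (q powr (1 / (1 - s))) powr (1 - s)"
      using s by (simp add: powr_powr)
    also have "\<dots> \<le> M powr (1 - s)"
      using \<open>0 < q\<close> s by (intro powr_mono2) (auto simp: M_def pos_powr_def q_def[symmetric])
    finally have "c * q \<le> c * M powr (1 - s)"
      using \<open>0 < c\<close> by simp
    thus ?thesis using s pos \<open>0 < ?m\<close> by (simp add: c_def q_def)
  qed
  \<comment> \<open>Monotonicity of \<open>K\<close> makes this hold also where \<open>y t\<close> exceeds \<open>R0\<close>, so no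
    continuation argument is needed to stay within the range of the lower bound on the kernel.\<close>
  have decay: "y' t \<le> 0" if "t \<in> I" "M < y t" for t
  proof -
    have "\<psi> \<le> ?m * K M"
      using M_stationary K_ge[of M] \<open>0 < M\<close> \<open>M \<le> R0\<close> by simp
    also have "\<dots> \<le> ?m * K (y t)"
      using that by (intro mult_left_mono kernel_primitive_mono) auto
    finally show ?thesis using y'_le[OF that(1)] by simp
  qed
  have y_le: "y t \<le> M" if "t \<in> I" for t
    by (rule barrier_le[OF deriv, where a = 0])
      (use I I_Icc that decay flow'(1) labels in \<open>auto simp: y_def M_def\<close>)
  \<comment> \<open>The power form requires \<open>y t \<le> R0\<close>, so it is derived after the
    bound \<open>y t \<le> M\<close>, in the reverse of the order in the statement.\<close>
  have "y' t \<le> \<psi> - c * y t powr (1 - s)" if "t \<in> I" for t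
    using y'_le[OF that] K_ge[of "y t"] y_pos[OF that] y_le[OF that] \<open>M \<le> R0\<close> by simp
  hence "\<forall>t\<in>I. \<exists>D. (y has_real_derivative D) (at t within I) \<and> D \<le> \<psi> - c * y t powr (1 - s)"
    using deriv by blast
  moreover have "bdd_above (y ` I)" using y_le by (rule bdd_aboveI2)
  moreover have "(SUP t\<in>I. y t) \<le> M" using y_le I(1) by (intro cSUP_least) auto
  ultimately show ?thesis
    using \<open>M \<le> R0\<close> unfolding y_def[abs_def] M_def c_def \<psi>_def by blast
qed

end
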